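(* For every sequent $\Gamma\Rightarrow\Delta$: if $\Gamma\Rightarrow\Delta$ is provable in $\mathsf{Grz}_\infty$, then $\Gamma\Rightarrow\Delta$ is provable in $\mathsf{Grz_{Seq}}$.
   Context: Formulas are given by $A ::= \bot \mid p \mid (A\to A)\mid \Box A$, where $p$ ranges over atomic propositions. A sequent is an expression $\Gamma\Rightarrow\Delta$ with $\Gamma,\Delta$ finite multisets of formulas; a comma denotes multiset union, and for $\Gamma=A_1,\dots,A_n$ we set $\Box\Gamma:=\Box A_1,\dots,\Box A_n$. Rules common to both calculi: - $(\to_L)$: from $\Gamma,B\Rightarrow\Delta$ and $\Gamma\Rightarrow A,\Delta$ infer $\Gamma,A\to B\Rightarrow\Delta$; - $(\to_R)$: from $\Gamma,A\Rightarrow B,\Delta$ infer $\Gamma\Rightarrow A\to B,\Delta$; - $(\mathsf{refl})$: from $\Gamma,A,\Box A\Rightarrow\Delta$ infer $\Gamma,\Box A\Rightarrow\Delta$. $\mathsf{Grz_{Seq}}$ has initial sequents $\Gamma,A\Rightarrow A,\Delta$ ($A$ any formula) and $\Gamma,\bot\Rightarrow\Delta$, and the rules $(\to_L)$, $(\to_R)$, $(\mathsf{refl})$ and $(\Box_{\mathsf{Grz}})$: from $\Box\Pi,\Box(A\to\Box A)\Rightarrow A$ infer $\Gamma,\Box\Pi\Rightarrow\Box A,\Delta$. Proofs in $\mathsf{Grz_{Seq}}$ are ordinary finite proof trees. $\mathsf{Grz}_\infty$ has initial sequents $\Gamma,p\Rightarrow p,\Delta$ ($p$ atomic) and $\Gamma,\bot\Rightarrow\Delta$,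 and the rules $(\to_L)$, $(\to_R)$, $(\mathsf{refl})$ and $(\Box)$: from $\Gamma,\Box\Pi\Rightarrow A,\Delta$ (left premise) and $\Box\Pi\Rightarrow A$ (right premise) infer $\Gamma,\Box\Pi\Rightarrow\Box A,\Delta$. An $\infty$-proof in $\mathsf{Grz}_\infty$ is a possibly infinite tree whose nodes are marked by sequents and whose leaves are marked by initial sequents, constructed according to these rules, such that every infinite branch passes through a right premise of $(\Box)$ infinitely many times. A sequent is provable in $\mathsf{Grz}_\infty$ if it marks the root of some $\infty$-proof in $\mathsf{Grz}_\infty$. *)

theory Defs
  imports Main "HOL-Library.Multiset"
begin

datatype 'a fm = Bot | Atom 'a | Imp "'a fm" "'a fm" | Box "'a fm"

datatype 'a sequent = Sequent "'a fm multiset" "'a fm multiset" (infix "\<turnstile>" 50)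

abbreviation boxes :: "'a fm multiset \<Rightarrow> 'a fm multiset" where
  "boxes \<Pi> \<equiv> image_mset Box \<Pi>"

inductive grz_seq :: "'a sequent \<Rightarrow> bool" where
  Ax: "grz_seq (\<Gamma> + {#A#} \<turnstile> {#A#} + \<Delta>)"
| BotL: "grz_seq (\<Gamma> + {#Bot#} \<turnstile> \<Delta>)"
| ImpL: "grz_seq (\<Gamma> + {#B#} \<turnstile> \<Delta>) \<Longrightarrow> grz_seq (\<Gamma> \<turnstile> {#A#} + \<Delta>) \<Longrightarrow>
    grz_seq (\<Gamma> + {#Imp A B#} \<turnstile> \<Delta>)"
| ImpR: "grz_seq (\<Gamma> + {#A#} \<turnstile> {#B#} + \<Delta>) \<Longrightarrow> grz_seq (\<Gamma> \<turnstile> {#Imp A B#} + \<Delta>)"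
| Refl: "grz_seq (\<Gamma> + {#A#} + {#Box A#} \<turnstile> \<Delta>) \<Longrightarrow> grz_seq (\<Gamma> + {#Box A#} \<turnstile> \<Delta>)"
| BoxGrz: "grz_seq (boxes \<Pi> + {#Box (Imp A (Box A))#} \<turnstile> {#A#}) \<Longrightarrow>
    grz_seq (\<Gamma> + boxes \<Pi> \<turnstile> {#Box A#} + \<Delta>)"

datatype rule_name = RInit | RImpL | RImpR | RRefl | RBox

text \<open>\<open>inf_rule r Ps S\<close>: the sequent \<open>S\<close> follows from the list of premises \<open>Ps\<close>, read from
  left to right, by an application of \<open>r\<close>. Initial sequents are the inferences without premises.\<close>

inductive inf_rule :: "rule_name \<Rightarrow> 'a sequent list \<Rightarrow> 'a sequent \<Rightarrow> bool" where
  "inf_rule RInit [] (\<Gamma> + {#Atom p#} \<turnstile> {#Atom p#} + \<Delta>)"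
| "inf_rule RInit [] (\<Gamma> + {#Bot#} \<turnstile> \<Delta>)"
| "inf_rule RImpL [\<Gamma> + {#B#} \<turnstile> \<Delta>, \<Gamma> \<turnstile> {#A#} + \<Delta>] (\<Gamma> + {#Imp A B#} \<turnstile> \<Delta>)"
| "inf_rule RImpR [\<Gamma> + {#A#} \<turnstile> {#B#} + \<Delta>] (\<Gamma> \<turnstile> {#Imp A B#} + \<Delta>)"
| "inf_rule RRefl [\<Gamma> + {#A#} + {#Box A#} \<turnstile> \<Delta>] (\<Gamma> + {#Box A#} \<turnstile> \<Delta>)"
| "inf_rule RBox [\<Gamma> + boxes \<Pi> \<turnstile> {#A#} + \<Delta>, boxes \<Pi> \<turnstile> {#A#}]
    (\<Gamma> + boxes \<Pi> \<turnstile> {#Box A#} + \<Delta>)"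

codatatype 'a ptree =
  Node (rule: rule_name) (root: "'a sequent") (prems: "'a ptree list")

coinductive locally_correct :: "'a ptree \<Rightarrow> bool" where
  "inf_rule r (map root ts) S \<Longrightarrow> \<forall>t\<in>set ts. locally_correct t \<Longrightarrow> locally_correct (Node r S ts)"

text \<open>An infinite branch is given by the subtrees \<open>s n\<close> it visits together with the indices
  \<open>d n\<close> of the premises it follows; the subtrees alone do not determine the branch, since distinct
  premises of an inference may carry equal subtrees.\<close>

definition infinite_branch :: "'a ptree \<Rightarrow> (nat \<Rightarrow> 'a ptree) \<Rightarrow> (nat \<Rightarrow> nat) \<Rightarrow> bool" where
  "infinite_branch t s d \<longleftrightarrow>
    s 0 = t \<and> (\<forall>n. d n < length (prems (s n)) \<and> s (Suc n) = prems (s n) ! d n)"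

text \<open>Premises are counted from 0, so \<open>d n = 1\<close> at an \<open>RBox\<close> inference selects its right premise.\<close>

definition inf_proof :: "'a ptree \<Rightarrow> bool" where
  "inf_proof t \<longleftrightarrow> locally_correct t \<and>
    (\<forall>s d. infinite_branch t s d \<longrightarrow> (\<exists>\<^sub>\<infinity>n. rule (s n) = RBox \<and> d n = 1))"

definition grz_inf :: "'a sequent \<Rightarrow> bool" where
  "grz_inf S \<longleftrightarrow> (\<exists>t. inf_proof t \<and> root t = S)"

end

theory Submission
  imports Defs "HOL-Library.Infinite_Set"
begin

text \<open>The two calculi differ essentially in their box rule. An \<open>\<infinity>\<close>-proof may return to the same
  right premise for ever, whereas a finite proof must record, by means of the additional antecedent
  \<open>\<box>(A \<rightarrow> \<box>A)\<close>, that the right premise for \<open>\<box>A\<close> has already been entered. The translation therefore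
  carries a finite set \<open>\<Lambda>\<close> of formulas already treated in this way, and turns an \<open>\<infinity>\<close>-proof of
  \<open>\<Gamma> \<Rightarrow> \<Delta>\<close> into a finite proof of \<open>\<Gamma>, {\<box>(A \<rightarrow> \<box>A) | A \<in> \<Lambda>} \<Rightarrow> \<Delta>\<close>
  (lemma \<open>grz_seq_guarded\<close>).

  At an inference with principal formula \<open>\<box>A\<close> there are two cases. If \<open>A \<notin> \<Lambda>\<close>, the right premise is
  translated with \<open>\<Lambda> \<union> {A}\<close>, and the box rule of the finite calculus applies. If \<open>A \<in> \<Lambda>\<close>, the right
  premise is discarded: the available \<open>\<box>(A \<rightarrow> \<box>A)\<close> yields \<open>\<box>A\<close> from \<open>A\<close>, and \<open>A\<close> is supplied by the
  left premise.

  This recursion ends. By the subformula property \<open>\<Lambda>\<close> stays within a fixed finite set, so it can grow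
  only finitely often; and while it does not grow, no right premise of a box inference is entered,
  so that the branch condition on \<open>\<infinity>\<close>-proofs makes the descent well-founded
  (lemma \<open>inf_proof_main_fragment_induct\<close>). Since the \<open>\<infinity>\<close>-proofs are cut-free, weakening is the
  only structural property of the finite calculus on which the argument relies.\<close>

lemma grz_seq_weakening:
  "grz_seq (\<Gamma> \<turnstile> \<Delta>) \<Longrightarrow> grz_seq (\<Gamma> + \<Gamma>' \<turnstile> \<Delta> + \<Delta>')"
proof (induction "\<Gamma> \<turnstile> \<Delta>" arbitrary: \<Gamma> \<Delta> rule: grz_seq.induct)
  case (Ax \<Gamma> A \<Delta>)
  show ?case using grz_seq.Ax[of "\<Gamma> + \<Gamma>'" A "\<Delta> + \<Delta>'"] by (simp add: ac_simps)
next
  case (BotL \<Gamma> \<Delta>)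
  show ?case using grz_seq.BotL[of "\<Gamma> + \<Gamma>'" "\<Delta> + \<Delta>'"] by (simp add: ac_simps)
next
  case (ImpL \<Gamma> B \<Delta> A)
  then show ?case
    using grz_seq.ImpL[of "\<Gamma> + \<Gamma>'" B "\<Delta> + \<Delta>'" A] by (simp add: ac_simps)
next
  case (ImpR \<Gamma> A B \<Delta>)
  then show ?case
    using grz_seq.ImpR[of "\<Gamma> + \<Gamma>'" A B "\<Delta> + \<Delta>'"] by (simp add: ac_simps)
next
  case (Refl \<Gamma> A \<Delta>)
  then show ?case
    using grz_seq.Refl[of "\<Gamma> + \<Gamma>'" A "\<Delta> + \<Delta>'"]
    by (simp add: add_mset_commute)
next
  case (BoxGrz \<Pi> A \<Gamma> \<Delta>)
  then show ?case
    using grz_seq.BoxGrz[of \<Pi> A "\<Gamma> + \<Gamma>'" "\<Delta> + \<Delta>'"] by (simp add: ac_simps)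
qed

text \<open>Reflexivity opens the guard \<open>\<box>(A \<rightarrow> \<box>A)\<close>; of the two premises of the resulting implication
  inference, one is an axiom and the other a weakening of the hypothesis.\<close>

lemma grz_seq_Box_from_guard:
  assumes "grz_seq (\<Gamma> + {#Box (Imp A (Box A))#} \<turnstile> {#A#} + \<Delta>)"
  shows "grz_seq (\<Gamma> + {#Box (Imp A (Box A))#} \<turnstile> {#Box A#} + \<Delta>)"
proof -
  let ?G = "\<Gamma> + {#Box (Imp A (Box A))#}"
  have "grz_seq (?G + {#Box A#} \<turnstile> {#Box A#} + \<Delta>)"
    by (rule grz_seq.Ax)
  moreover have "grz_seq (?G \<turnstile> {#A#} + ({#Box A#} + \<Delta>))"
    using grz_seq_weakening[OF assms, of "{#}" "{#Box A#}"] by (simp add: ac_simps)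
  ultimately have "grz_seq (?G + {#Imp A (Box A)#} \<turnstile> {#Box A#} + \<Delta>)"
    by (rule grz_seq.ImpL)
  then show ?thesis
    using grz_seq.Refl[of \<Gamma> "Imp A (Box A)" "{#Box A#} + \<Delta>"] by (simp add: ac_simps)
qed

lemma inf_proof_prem:
  assumes "inf_proof t" "i < length (prems t)"
  shows "inf_proof (prems t ! i)"
  unfolding inf_proof_def
proof (intro conjI allI impI)
  from assms show "locally_correct (prems t ! i)"
    by (auto simp: inf_proof_def elim: locally_correct.cases)
next
  fix s d
  assume "infinite_branch (prems t ! i) s d"
  with assms(2) have "infinite_branch t (case_nat t s) (case_nat i d)"
    by (auto simp: infinite_branch_def split: nat.split)
  with assms(1) have "\<exists>\<^sub>\<infinity>n. rule (case_nat t s n) = RBox \<and> case_nat i d n = 1"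
    unfolding inf_proof_def by blast
  then have *: "\<forall>m. \<exists>n>m. rule (case_nat t s n) = RBox \<and> case_nat i d n = 1"
    unfolding INFM_nat .
  show "\<exists>\<^sub>\<infinity>n. rule (s n) = RBox \<and> d n = 1"
    unfolding INFM_nat
  proof
    fix m
    from * obtain n where "n > Suc m" "rule (case_nat t s n) = RBox" "case_nat i d n = 1"
      by blast
    then show "\<exists>n>m. rule (s n) = RBox \<and> d n = 1"
      by (cases n) auto
  qed
qed

text \<open>A branch that enters no right premise of a box inference violates the condition on infinite
  branches unless it is finite. Hence an \<open>\<infinity>\<close>-proof admits induction along all other premises.\<close>

lemma inf_proof_main_fragment_induct [consumes 1, case_names step]:
  fixes t :: "'a ptree"
  assumes "inf_proof t"
    and step: "\<And>t. inf_proof t \<Longrightarrow>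
      (\<And>i. i < length (prems t) \<Longrightarrow> \<not> (rule t = RBox \<and> i = 1) \<Longrightarrow> P (prems t ! i)) \<Longrightarrow> P t"
  shows "P t"
proof -
  let ?sel = "\<lambda>(u :: 'a ptree) (v :: 'a ptree) i. i < length (prems v) \<and> u = prems v ! i \<and> \<not> (rule v = RBox \<and> i = 1)"
  let ?R = "{(u, v). inf_proof v \<and> (\<exists>i. ?sel u v i)}"
  have "wf ?R"
    unfolding wf_iff_no_infinite_down_chain
  proof
    assume "\<exists>s. \<forall>n. (s (Suc n), s n) \<in> ?R"
    then obtain s where R: "\<forall>n. (s (Suc n), s n) \<in> ?R" ..
    have s: "inf_proof (s n)" "\<exists>i. ?sel (s (Suc n)) (s n) i" for n
      using R[rule_format, of n] by auto
    then have "\<exists>d. \<forall>n. ?sel (s (Suc n)) (s n) (d n)"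
      by (intro choice allI)
    then obtain d where "\<forall>n. ?sel (s (Suc n)) (s n) (d n)" ..
    then have d: "?sel (s (Suc n)) (s n) (d n)" for n
      by (rule spec)
    then have "infinite_branch (s 0) s d"
      by (simp add: infinite_branch_def)
    with s(1)[of 0] have "\<exists>\<^sub>\<infinity>n. rule (s n) = RBox \<and> d n = 1"
      unfolding inf_proof_def by blast
    then obtain n where "rule (s n) = RBox \<and> d n = 1"
      by (rule INFM_E)
    with d[of n] show False
      by blast
  qed
  then show ?thesis
    using assms(1)
  proof (induction t rule: wf_induct_rule)
    case (less t)
    show ?case
    proof (rule step)
      fix i
      assume "i < length (prems t)" "\<not> (rule t = RBox \<and> i = 1)"
      with less.prems show "P (prems t ! i)"
        by (intro less.IH) (auto intro: inf_proof_prem)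
    qed (fact less.prems)
  qed
qed

text \<open>Only formulas directly below a box can ever enter the set of guards, so these are the only
  subformulas to be counted.\<close>

primrec boxed_subfms :: "'a fm \<Rightarrow> 'a fm set" where
  "boxed_subfms Bot = {}"
| "boxed_subfms (Atom p) = {}"
| "boxed_subfms (Imp A B) = boxed_subfms A \<union> boxed_subfms B"
| "boxed_subfms (Box A) = insert A (boxed_subfms A)"

lemma finite_boxed_subfms: "finite (boxed_subfms A)"
  by (induction A) auto

definition guards :: "'a fm set \<Rightarrow> 'a fm multiset" where
  "guards \<Lambda> = boxes (image_mset (\<lambda>A. Imp A (Box A)) (mset_set \<Lambda>))"

lemma guards_insert:
  "finite \<Lambda> \<Longrightarrow> A \<notin> \<Lambda> \<Longrightarrow> guards (insert A \<Lambda>) = guards \<Lambda> + {#Box (Imp A (Box A))#}"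
  by (simp add: guards_def)

text \<open>The outer induction is on the number of formulas not yet guarded, the inner one on the part of
  the \<open>\<infinity>\<close>-proof that is reached without entering a right premise of a box inference. Stating the
  subformula property as inclusion in a fixed set \<open>U\<close> makes the outer measure depend on \<open>\<Lambda>\<close> alone,
  and not on the sequent, which changes along the inner induction.\<close>

lemma grz_seq_guarded:
  assumes "finite U" "\<Lambda> \<subseteq> U" "inf_proof t" "root t = (\<Gamma> \<turnstile> \<Delta>)"
    and "\<Union> (boxed_subfms ` set_mset (\<Gamma> + \<Delta>)) \<subseteq> U"
  shows "grz_seq (\<Gamma> + guards \<Lambda> \<turnstile> \<Delta>)"
  using assms(2-)
proof (induction "card (U - \<Lambda>)" arbitrary: \<Lambda> t \<Gamma> \<Delta> rule: less_induct)
  case (less \<Lambda>)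
  note outer_IH = less.hyps and \<Lambda> = less.prems(1)
  from \<Lambda> \<open>finite U\<close> have fin: "finite \<Lambda>" by (rule finite_subset)
  from less.prems(2-) show ?case
  proof (induction t arbitrary: \<Gamma> \<Delta> rule: inf_proof_main_fragment_induct)
    case (step t)
    note sub = \<open>\<Union> (boxed_subfms ` set_mset (\<Gamma> + \<Delta>)) \<subseteq> U\<close>
    have IH: "grz_seq (\<Gamma>' + guards \<Lambda> \<turnstile> \<Delta>')"
      if "i < length (map root (prems t))" "\<not> (rule t = RBox \<and> i = 1)"
        "map root (prems t) ! i = (\<Gamma>' \<turnstile> \<Delta>')"
        "\<Union> (boxed_subfms ` set_mset (\<Gamma>' + \<Delta>')) \<subseteq> U" for i \<Gamma>' \<Delta>'
      using that by (intro step.IH) auto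
    from \<open>inf_proof t\<close> \<open>root t = (\<Gamma> \<turnstile> \<Delta>)\<close>
    have "inf_rule (rule t) (map root (prems t)) (\<Gamma> \<turnstile> \<Delta>)"
      by (auto simp: inf_proof_def elim: locally_correct.cases)
    then show ?case
    proof cases
      case (1 \<Gamma>' p \<Delta>')
      then show ?thesis
        using grz_seq.Ax[of "\<Gamma>' + guards \<Lambda>" "Atom p" \<Delta>'] by (simp add: ac_simps)
    next
      case (2 \<Gamma>')
      then show ?thesis
        using grz_seq.BotL[of "\<Gamma>' + guards \<Lambda>" \<Delta>] by (simp add: ac_simps)
    next
      case (3 \<Gamma>' B A)
      have "grz_seq ((\<Gamma>' + {#B#}) + guards \<Lambda> \<turnstile> \<Delta>)"
        by (rule IH[of 0]) (use 3 sub in auto)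
      moreover have "grz_seq (\<Gamma>' + guards \<Lambda> \<turnstile> {#A#} + \<Delta>)"
        by (rule IH[of 1]) (use 3 sub in auto)
      ultimately show ?thesis
        using grz_seq.ImpL[of "\<Gamma>' + guards \<Lambda>" B \<Delta> A] 3 by (simp add: ac_simps)
    next
      case (4 A B \<Delta>')
      have "grz_seq ((\<Gamma> + {#A#}) + guards \<Lambda> \<turnstile> {#B#} + \<Delta>')"
        by (rule IH[of 0]) (use 4 sub in auto)
      then show ?thesis
        using grz_seq.ImpR[of "\<Gamma> + guards \<Lambda>" A B \<Delta>'] 4 by (simp add: ac_simps)
    next
      case (5 \<Gamma>' A)
      have "grz_seq ((\<Gamma>' + {#A#} + {#Box A#}) + guards \<Lambda> \<turnstile> \<Delta>)"
        by (rule IH[of 0]) (use 5 sub in auto)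
      then show ?thesis
        using grz_seq.Refl[of "\<Gamma>' + guards \<Lambda>" A \<Delta>] 5
        by (simp add: add_mset_commute)
    next
      case (6 \<Gamma>' \<Pi> A \<Delta>')
      show ?thesis
      proof (cases "A \<in> \<Lambda>")
        case True
        let ?\<Theta> = "\<Gamma>' + boxes \<Pi> + guards (\<Lambda> - {A})"
        have guards_split: "guards \<Lambda> = guards (\<Lambda> - {A}) + {#Box (Imp A (Box A))#}"
          using guards_insert[of "\<Lambda> - {A}" A] fin True by (simp add: insert_absorb)
        have "grz_seq ((\<Gamma>' + boxes \<Pi>) + guards \<Lambda> \<turnstile> {#A#} + \<Delta>')"
          by (rule IH[of 0]) (use 6 sub in auto)
        then have "grz_seq (?\<Theta> + {#Box (Imp A (Box A))#} \<turnstile> {#A#} + \<Delta>')"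
          by (simp add: guards_split ac_simps)
        then have "grz_seq (?\<Theta> + {#Box (Imp A (Box A))#} \<turnstile> {#Box A#} + \<Delta>')"
          by (rule grz_seq_Box_from_guard)
        then show ?thesis
          using 6 by (simp add: guards_split ac_simps)
      next
        case False
        have len: "length (prems t) = 2" and rt: "root (prems t ! 1) = (boxes \<Pi> \<turnstile> {#A#})"
          using \<open>map root (prems t) = _\<close> by auto
        have AU: "A \<in> U"
          using 6 sub by auto
        have "grz_seq (boxes \<Pi> + guards (insert A \<Lambda>) \<turnstile> {#A#})"
        proof (rule outer_IH)
          show "card (U - insert A \<Lambda>) < card (U - \<Lambda>)"
            using AU False \<open>finite U\<close> by (intro psubset_card_mono) auto
          show "inf_proof (prems t ! 1)"
            using \<open>inf_proof t\<close> len by (simp add: inf_proof_prem)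
          show "\<Union> (boxed_subfms ` set_mset (boxes \<Pi> + {#A#})) \<subseteq> U"
            using 6 sub by auto
        qed (use AU \<Lambda> rt in auto)
        then have "grz_seq (boxes \<Pi> + guards \<Lambda> + {#Box (Imp A (Box A))#} \<turnstile> {#A#})"
          using fin False by (simp add: guards_insert ac_simps)
        \<comment> \<open>The guards are boxed formulas themselves, so they survive the passage through the rule.\<close>
        then have "grz_seq (\<Gamma>' + (boxes \<Pi> + guards \<Lambda>) \<turnstile> {#Box A#} + \<Delta>')"
          using grz_seq.BoxGrz[of "\<Pi> + image_mset (\<lambda>A. Imp A (Box A)) (mset_set \<Lambda>)" A \<Gamma>' \<Delta>']
          by (simp add: guards_def)
        then show ?thesis
          using 6 by (simp add: ac_simps)
      qed
    qed
  qed
qed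

theorem theorem5p6:
  fixes \<Gamma> \<Delta> :: "'a fm multiset"
  assumes "grz_inf (\<Gamma> \<turnstile> \<Delta>)"
  shows "grz_seq (\<Gamma> \<turnstile> \<Delta>)"
proof -
  from assms obtain t where "inf_proof t" "root t = (\<Gamma> \<turnstile> \<Delta>)"
    unfolding grz_inf_def by blast
  moreover have "finite (\<Union> (boxed_subfms ` set_mset (\<Gamma> + \<Delta>)))"
    by (intro finite_UN_I finite_set_mset finite_boxed_subfms)
  ultimately have "grz_seq (\<Gamma> + guards {} \<turnstile> \<Delta>)"
    by (intro grz_seq_guarded[OF _ empty_subsetI]) (assumption | rule subset_refl)+
  then show ?thesis
    by (simp add: guards_def)
qed

end
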